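(* Let $\mathcal{M}=\langle S,R,V\rangle$ be a Kripke model and let $ue(\mathcal{M})$ be its ($\forall$-version) ultrafilter extension for contingency logic. For all formulas $\phi\in\mathcal{L}(\nabla)$ and all ultrafilters $s$ over $S$, we have $V(\phi)\in s$ iff $ue(\mathcal{M}),s\vDash\phi$. As a corollary, for all $w\in S$, we have $(\mathcal{M},w)\equiv_{\mathcal{L}(\nabla)}(ue(\mathcal{M}),\pi_w)$.
   Context: A Kripke model is $\mathcal{M}=\langle S,R,V\rangle$ with $S\neq\emptyset$, $R\subseteq S\times S$, $V:\mathbf{P}\to\mathcal{P}(S)$, where $\mathbf{P}$ is the set of propositional variables. $\mathcal{L}(\nabla)$ is the propositional language with $\neg,\wedge$ and a unary operator $\nabla$ (contingency); $\Delta\phi$ abbreviates $\neg\nabla\phi$. Semantics: $\mathcal{M},s\vDash\nabla\phi$ iff there are $t,u\in S$ with $Rst$, $Rsu$, $\mathcal{M},t\vDash\phi$ and $\mathcal{M},u\nvDash\phi$; Booleans as usual. $V(\phi)=\{x\in S\mid\mathcal{M},x\vDash\phi\}$. $\equiv_{\mathcal{L}(\nabla)}$ between pointed models means satisfying the same $\mathcal{L}(\nabla)$-formulas. For $X\subseteq S$, $m_\Delta(X)=\{s\in S\mid\text{for all }t,u,\text{ if }Rst\text{ and }Rsu,\text{ then }(t\in X\text{ iff }u\in X)\}$. Ultrafilter extension ($\forall$-version): $ue(\mathcal{M})=\langle Uf(S),R^{ue},V^{ue}\rangle$, where $Uf(S)$ is the set of all ultrafilters over $S$; $R^{ue}st$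 iff for all $Y\subseteq S$, if $m_\Delta(X\cup Y)\in s$ for all $X\subseteq S$, then $Y\in t$; and $V^{ue}(p)=\{s\in Uf(S)\mid V(p)\in s\}$. For $w\in S$, $\pi_w=\{X\subseteq S\mid w\in X\}$. *)

theory Defs
  imports Main
begin

datatype 'p fm =
    Prop 'p
  | Neg "'p fm"
  | Conj "'p fm" "'p fm"
  | Nabla "'p fm"

(* The set of worlds is an explicit carrier rather than a whole type, since the worlds of an
   ultrafilter extension are only the ultrafilters among all families of sets. *)
record ('w, 'p) kripke =
  worlds :: "'w set"
  rel :: "('w \<times> 'w) set"
  val :: "'p \<Rightarrow> 'w set"

definition kripke_model :: "('w, 'p) kripke \<Rightarrow> bool" where
  "kripke_model M \<longleftrightarrow>
     worlds M \<noteq> {} \<and> rel M \<subseteq> worlds M \<times> worlds M \<and> (\<forall>p. val M p \<subseteq> worlds M)"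

primrec sat :: "('w, 'p) kripke \<Rightarrow> 'w \<Rightarrow> 'p fm \<Rightarrow> bool" where
  "sat M s (Prop p) \<longleftrightarrow> s \<in> val M p"
| "sat M s (Neg \<phi>) \<longleftrightarrow> \<not> sat M s \<phi>"
| "sat M s (Conj \<phi> \<psi>) \<longleftrightarrow> sat M s \<phi> \<and> sat M s \<psi>"
| "sat M s (Nabla \<phi>) \<longleftrightarrow>
     (\<exists>t\<in>worlds M. \<exists>u\<in>worlds M.
        (s, t) \<in> rel M \<and> (s, u) \<in> rel M \<and> sat M t \<phi> \<and> \<not> sat M u \<phi>)"

definition truth_set :: "('w, 'p) kripke \<Rightarrow> 'p fm \<Rightarrow> 'w set" where
  "truth_set M \<phi> = {x \<in> worlds M. sat M x \<phi>}"

definition nabla_equiv ::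
    "('w, 'p) kripke \<Rightarrow> 'w \<Rightarrow> ('v, 'p) kripke \<Rightarrow> 'v \<Rightarrow> bool" where
  "nabla_equiv M w N v \<longleftrightarrow> (\<forall>\<phi>. sat M w \<phi> \<longleftrightarrow> sat N v \<phi>)"

definition m_Delta :: "('w, 'p) kripke \<Rightarrow> 'w set \<Rightarrow> 'w set" where
  "m_Delta M X =
     {s \<in> worlds M. \<forall>t u. (s, t) \<in> rel M \<and> (s, u) \<in> rel M \<longrightarrow> (t \<in> X \<longleftrightarrow> u \<in> X)}"

definition filter_over :: "'a set \<Rightarrow> 'a set set \<Rightarrow> bool" where
  "filter_over S F \<longleftrightarrow>
     F \<subseteq> Pow S \<and> S \<in> F \<and>
     (\<forall>X\<in>F. \<forall>Y\<in>F. X \<inter> Y \<in> F) \<and>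
     (\<forall>X\<in>F. \<forall>Y. X \<subseteq> Y \<and> Y \<subseteq> S \<longrightarrow> Y \<in> F)"

definition ultrafilter_over :: "'a set \<Rightarrow> 'a set set \<Rightarrow> bool" where
  "ultrafilter_over S F \<longleftrightarrow>
     filter_over S F \<and> {} \<notin> F \<and> (\<forall>X\<subseteq>S. X \<in> F \<longleftrightarrow> S - X \<notin> F)"

definition Uf :: "'a set \<Rightarrow> 'a set set set" where
  "Uf S = {F. ultrafilter_over S F}"

definition ue :: "('w, 'p) kripke \<Rightarrow> ('w set set, 'p) kripke" where
  "ue M = \<lparr>
     worlds = Uf (worlds M),
     rel = {(s, t). s \<in> Uf (worlds M) \<and> t \<in> Uf (worlds M) \<and>
              (\<forall>Y\<subseteq>worlds M.
                 (\<forall>X\<subseteq>worlds M. m_Delta M (X \<union> Y) \<in> s) \<longrightarrow> Y \<in> t)},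
     val = (\<lambda>p. {s \<in> Uf (worlds M). val M p \<in> s}) \<rparr>"

definition principal_uf :: "'a set \<Rightarrow> 'a \<Rightarrow> 'a set set" where
  "principal_uf S w = {X. X \<subseteq> S \<and> w \<in> X}"

lemma principal_uf_in_Uf: "w \<in> S \<Longrightarrow> principal_uf S w \<in> Uf S"
  unfolding Uf_def ultrafilter_over_def filter_over_def principal_uf_def by auto

lemma kripke_model_ue: "kripke_model M \<Longrightarrow> kripke_model (ue M)"
  using principal_uf_in_Uf unfolding kripke_model_def ue_def by fastforce

end

theory Submission
  imports Defs
begin

text \<open>The first claim is an induction on formulas in which only \<open>\<nabla>\<phi>\<close> needs an idea. Write
  \<open>A\<close> for the truth set of \<open>\<phi>\<close>; then \<open>\<nabla>\<phi>\<close> is true exactly off \<open>m_Delta M A\<close>. By definition the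
  successors of an ultrafilter \<open>s\<close> in \<open>ue M\<close> are the ultrafilters that include
  \<open>necessary_sets M s\<close>, the family of all \<open>Y\<close> such that \<open>m_Delta M (X \<union> Y) \<in> s\<close> for every \<open>X\<close>.
  This family is a filter, so it behaves like the sets that are necessary at \<open>s\<close>, and everything
  follows from one equivalence (\<open>m_Delta_in_ultrafilter_iff\<close>): \<open>m_Delta M A\<close> belongs to \<open>s\<close> iff
  \<open>A\<close> or its complement is necessary at \<open>s\<close>.

  If one of the two is necessary, all successors of \<open>s\<close> agree on \<open>A\<close>, and \<open>\<nabla>\<phi>\<close> fails at \<open>s\<close>. If
  neither is, the ultrafilter theorem (\<open>filter_extends_to_ultrafilter\<close>) extends the filter of
  necessary sets once by \<open>A\<close> and once by its complement, and the two ultrafilters are successors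
  that witness \<open>\<nabla>\<phi>\<close> at \<open>s\<close>.

  The second claim is the first one at principal ultrafilters.\<close>

section \<open>Extending filters to ultrafilters\<close>

text \<open>The filter generated by \<open>F\<close> and \<open>X\<close>; one member of \<open>F\<close> suffices in the condition because \<open>F\<close>
  is to be closed under intersection.\<close>

definition filter_adjoin :: "'a set \<Rightarrow> 'a set set \<Rightarrow> 'a set \<Rightarrow> 'a set set" where
  "filter_adjoin S F X = {Z. Z \<subseteq> S \<and> (\<exists>Y\<in>F. Y \<inter> X \<subseteq> Z)}"

lemma filter_overI:
  assumes "F \<subseteq> Pow S" "S \<in> F"
    and "\<And>X Y. X \<in> F \<Longrightarrow> Y \<in> F \<Longrightarrow> X \<inter> Y \<in> F"
    and "\<And>X Y. X \<in> F \<Longrightarrow> X \<subseteq> Y \<Longrightarrow> Y \<subseteq> S \<Longrightarrow> Y \<in> F"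
  shows "filter_over S F"
  unfolding filter_over_def using assms by simp

lemma filter_overD:
  assumes "filter_over S F"
  shows "X \<in> F \<Longrightarrow> X \<subseteq> S" "S \<in> F"
    and "X \<in> F \<Longrightarrow> Y \<in> F \<Longrightarrow> X \<inter> Y \<in> F"
    and "X \<in> F \<Longrightarrow> X \<subseteq> Y \<Longrightarrow> Y \<subseteq> S \<Longrightarrow> Y \<in> F"
  using assms by (auto simp: filter_over_def)

lemma filter_over_filter_adjoin:
  assumes F: "filter_over S F"
  shows "filter_over S (filter_adjoin S F X)"
proof (rule filter_overI)
  show "filter_adjoin S F X \<subseteq> Pow S"
    unfolding filter_adjoin_def by blast
  show "S \<in> filter_adjoin S F X"
    using filter_overD(2)[OF F] unfolding filter_adjoin_def by blast
next
  fix Z Z' assume "Z \<in> filter_adjoin S F X" "Z' \<in> filter_adjoin S F X"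
  then obtain Y Y' where "Z \<subseteq> S" "Y \<in> F" "Y' \<in> F" "Y \<inter> X \<subseteq> Z" "Y' \<inter> X \<subseteq> Z'"
    unfolding filter_adjoin_def by blast
  moreover from this have "Y \<inter> Y' \<in> F"
    using filter_overD(3)[OF F] by blast
  moreover have "(Y \<inter> Y') \<inter> X \<subseteq> Z \<inter> Z'"
    using calculation by blast
  ultimately show "Z \<inter> Z' \<in> filter_adjoin S F X"
    unfolding filter_adjoin_def by blast
next
  fix Z Z' assume "Z \<in> filter_adjoin S F X" "Z \<subseteq> Z'" "Z' \<subseteq> S"
  then show "Z' \<in> filter_adjoin S F X"
    unfolding filter_adjoin_def by blast
qed

lemma subset_filter_adjoin:
  assumes "filter_over S F"
  shows "F \<subseteq> filter_adjoin S F X"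
  using filter_overD(1)[OF assms] unfolding filter_adjoin_def by blast

lemma mem_filter_adjoin:
  assumes "filter_over S F" "X \<subseteq> S"
  shows "X \<in> filter_adjoin S F X"
  using filter_overD(2)[OF assms(1)] assms(2) unfolding filter_adjoin_def by blast

lemma empty_notin_filter_adjoin:
  assumes F: "filter_over S F" and "S - X \<notin> F"
  shows "{} \<notin> filter_adjoin S F X"
proof
  assume "{} \<in> filter_adjoin S F X"
  then obtain Y where Y: "Y \<in> F" "Y \<inter> X = {}"
    unfolding filter_adjoin_def by blast
  then have "Y \<subseteq> S - X"
    using filter_overD(1)[OF F] by blast
  then have "S - X \<in> F"
    using filter_overD(4)[OF F Y(1)] by blast
  with assms(2) show False ..
qed

text \<open>Zorn's lemma gives a maximal proper filter above \<open>F\<close>. It decides every \<open>X \<subseteq> S\<close>: if it omits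
  \<open>S - X\<close>, then adjoining \<open>X\<close> keeps it proper, so by maximality it already contains \<open>X\<close>.\<close>

lemma proper_filter_extends_to_ultrafilter:
  assumes F: "filter_over S F" and "{} \<notin> F"
  shows "\<exists>U. ultrafilter_over S U \<and> F \<subseteq> U"
proof -
  define P where "P = {G. filter_over S G \<and> {} \<notin> G \<and> F \<subseteq> G}"
  have chain_Union: "\<Union>C \<in> P" if "C \<noteq> {}" and C: "subset.chain P C" for C
  proof -
    have comparable: "G \<subseteq> H \<or> H \<subseteq> G" if "G \<in> C" "H \<in> C" for G H
      using C that unfolding subset_chain_def by simp
    have "C \<subseteq> P" using C unfolding subset_chain_def by simp
    then have filters: "filter_over S G" and proper: "{} \<notin> G" and above: "F \<subseteq> G"
      if "G \<in> C" for G
      using that unfolding P_def by auto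
    obtain G0 where G0: "G0 \<in> C" using \<open>C \<noteq> {}\<close> by blast
    have "filter_over S (\<Union>C)"
    proof (rule filter_overI)
      show "\<Union>C \<subseteq> Pow S" using filter_overD(1)[OF filters] by auto
      show "S \<in> \<Union>C" using filter_overD(2)[OF filters[OF G0]] G0 by blast
    next
      fix X Y assume "X \<in> \<Union>C" "Y \<in> \<Union>C"
      then obtain G H where "G \<in> C" "H \<in> C" "X \<in> G" "Y \<in> H" by blast
      then obtain K where K: "K \<in> C" "X \<in> K" "Y \<in> K"
        using comparable[of G H] by blast
      then have "X \<inter> Y \<in> K" using filter_overD(3)[OF filters] by simp
      with K(1) show "X \<inter> Y \<in> \<Union>C" by blast
    next
      fix X Y assume "X \<in> \<Union>C" "X \<subseteq> Y" "Y \<subseteq> S"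
      then obtain G where G: "G \<in> C" "X \<in> G" by blast
      then have "Y \<in> G" using filter_overD(4)[OF filters] \<open>X \<subseteq> Y\<close> \<open>Y \<subseteq> S\<close> by simp
      with G(1) show "Y \<in> \<Union>C" by blast
    qed
    moreover have "{} \<notin> \<Union>C" using proper by blast
    moreover have "F \<subseteq> \<Union>C" using above[OF G0] G0 by blast
    ultimately show ?thesis unfolding P_def by simp
  qed
  have "P \<noteq> {}" using assms unfolding P_def by auto
  then obtain U where "U \<in> P" and max_P: "\<forall>G\<in>P. U \<subseteq> G \<longrightarrow> G = U"
    using subset_Zorn_nonempty[of P] chain_Union by metis
  then have U: "filter_over S U" "{} \<notin> U" "F \<subseteq> U"
    unfolding P_def by simp_all
  have maximal: "G = U" if "filter_over S G" "{} \<notin> G" "U \<subseteq> G" for G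
    using max_P that U(3) unfolding P_def by simp
  have "X \<in> U \<longleftrightarrow> S - X \<notin> U" if "X \<subseteq> S" for X
  proof
    assume "X \<in> U"
    then show "S - X \<notin> U"
      using filter_overD(3)[OF U(1), of X "S - X"] U(2) by auto
  next
    assume "S - X \<notin> U"
    then have "filter_adjoin S U X = U"
      by (intro maximal filter_over_filter_adjoin[OF U(1)] empty_notin_filter_adjoin[OF U(1)]
        subset_filter_adjoin[OF U(1)])
    then show "X \<in> U" using mem_filter_adjoin[OF U(1) that] by simp
  qed
  with U show ?thesis unfolding ultrafilter_over_def by blast
qed

text \<open>The hypothesis on \<open>S - X\<close> is what lets \<open>X\<close> join the ultrafilter: \<open>F\<close> and \<open>X\<close>
  together have the finite intersection property, because a member of \<open>F\<close> disjoint from \<open>X\<close> would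
  lie below \<open>S - X\<close>.\<close>

lemma filter_extends_to_ultrafilter:
  assumes F: "filter_over S F" and X: "X \<subseteq> S" "S - X \<notin> F"
  shows "\<exists>U. ultrafilter_over S U \<and> F \<subseteq> U \<and> X \<in> U"
proof -
  obtain U where "ultrafilter_over S U" "filter_adjoin S F X \<subseteq> U"
    using proper_filter_extends_to_ultrafilter[OF filter_over_filter_adjoin[OF F]
        empty_notin_filter_adjoin[OF F X(2)]] by blast
  then show ?thesis
    using subset_filter_adjoin[OF F, of X] mem_filter_adjoin[OF F X(1)] by blast
qed

lemma Uf_filter_over:
  assumes "s \<in> Uf S"
  shows "filter_over S s"
  using assms unfolding Uf_def ultrafilter_over_def by blast

lemma ultrafilter_Compl_iff:
  assumes "s \<in> Uf S" "X \<subseteq> S"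
  shows "S - X \<in> s \<longleftrightarrow> X \<notin> s"
  using assms unfolding Uf_def ultrafilter_over_def by blast

lemma ultrafilter_Int_iff:
  assumes "s \<in> Uf S" "X \<subseteq> S" "Y \<subseteq> S"
  shows "X \<inter> Y \<in> s \<longleftrightarrow> X \<in> s \<and> Y \<in> s"
proof -
  note s = Uf_filter_over[OF assms(1)]
  show ?thesis
    using filter_overD(3)[OF s] filter_overD(4)[OF s _ Int_lower1 assms(2)]
      filter_overD(4)[OF s _ Int_lower2 assms(3)] by blast
qed

section \<open>Necessity at an ultrafilter\<close>

text \<open>In the language of contingency necessity is not expressible; the quantification over \<open>X\<close>
  recovers it up to worlds with at most one successor. If \<open>s\<close> is the principal ultrafilter of
  \<open>w\<close>, then \<open>Y\<close> is in the family iff it includes all successors of \<open>w\<close> or \<open>w\<close> has at most one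
  successor.\<close>

definition necessary_sets :: "('w, 'p) kripke \<Rightarrow> 'w set set \<Rightarrow> 'w set set" where
  "necessary_sets M s =
     {Y. Y \<subseteq> worlds M \<and> (\<forall>X\<subseteq>worlds M. m_Delta M (X \<union> Y) \<in> s)}"

lemma necessary_setsD:
  assumes "Y \<in> necessary_sets M s"
  shows "Y \<subseteq> worlds M" and "X \<subseteq> worlds M \<Longrightarrow> m_Delta M (X \<union> Y) \<in> s"
  using assms unfolding necessary_sets_def by simp_all

lemma rel_ue_iff:
  "(s, t) \<in> rel (ue M) \<longleftrightarrow>
     s \<in> Uf (worlds M) \<and> t \<in> Uf (worlds M) \<and> necessary_sets M s \<subseteq> t"
  unfolding ue_def necessary_sets_def by auto

lemma worlds_ue [simp]: "worlds (ue M) = Uf (worlds M)"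
  unfolding ue_def by simp

lemma m_Delta_subset: "m_Delta M X \<subseteq> worlds M"
  unfolding m_Delta_def by blast

lemma m_Delta_Int_subset: "m_Delta M X \<inter> m_Delta M Y \<subseteq> m_Delta M (X \<inter> Y)"
  unfolding m_Delta_def by blast

lemma m_Delta_Compl:
  assumes "kripke_model M"
  shows "m_Delta M (worlds M - X) = m_Delta M X"
  using assms unfolding m_Delta_def kripke_model_def by blast

lemma m_Delta_worlds:
  assumes "kripke_model M"
  shows "m_Delta M (worlds M) = worlds M"
  using assms unfolding m_Delta_def kripke_model_def by blast

text \<open>Closure under intersection holds because \<open>X \<union> (Y \<inter> Z) = (X \<union> Y) \<inter> (X \<union> Z)\<close> and noncontingent
  sets are closed under intersection. Upward closure, which fails for noncontingency, is forced
  by the quantification over \<open>X\<close>: if \<open>Y \<subseteq> Z\<close>, then \<open>X \<union> Z = (X \<union> Z) \<union> Y\<close>.\<close>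

lemma filter_over_necessary_sets:
  assumes M: "kripke_model M" and s: "filter_over (worlds M) s"
  shows "filter_over (worlds M) (necessary_sets M s)"
proof (rule filter_overI)
  show "necessary_sets M s \<subseteq> Pow (worlds M)"
    unfolding necessary_sets_def by blast
  show "worlds M \<in> necessary_sets M s"
    unfolding necessary_sets_def
    using m_Delta_worlds[OF M] filter_overD(2)[OF s] by (auto simp: Un_absorb1)
next
  fix Y Z assume YZ: "Y \<in> necessary_sets M s" "Z \<in> necessary_sets M s"
  have "m_Delta M (X \<union> (Y \<inter> Z)) \<in> s" if "X \<subseteq> worlds M" for X
  proof -
    have "m_Delta M (X \<union> Y) \<inter> m_Delta M (X \<union> Z) \<in> s"
      using YZ that by (intro filter_overD(3)[OF s] necessary_setsD(2))
    moreover have "m_Delta M (X \<union> Y) \<inter> m_Delta M (X \<union> Z) \<subseteq> m_Delta M (X \<union> (Y \<inter> Z))"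
      using m_Delta_Int_subset[of M "X \<union> Y" "X \<union> Z"] by (simp add: Un_Int_distrib)
    ultimately show ?thesis
      by (rule filter_overD(4)[OF s _ _ m_Delta_subset])
  qed
  then show "Y \<inter> Z \<in> necessary_sets M s"
    using necessary_setsD(1)[OF YZ(1)] unfolding necessary_sets_def by auto
next
  fix Y Z assume Y: "Y \<in> necessary_sets M s" and YZ: "Y \<subseteq> Z" "Z \<subseteq> worlds M"
  have "m_Delta M (X \<union> Z) \<in> s" if "X \<subseteq> worlds M" for X
  proof -
    have "m_Delta M ((X \<union> Z) \<union> Y) \<in> s"
      using YZ that by (intro necessary_setsD(2)[OF Y]) simp
    moreover have "(X \<union> Z) \<union> Y = X \<union> Z" using YZ by blast
    ultimately show ?thesis by simp
  qed
  then show "Z \<in> necessary_sets M s"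
    using YZ unfolding necessary_sets_def by simp
qed

text \<open>At worlds all of whose successors lie in \<open>A\<close>, every superset of \<open>A\<close> is noncontingent. Hence a
  filter that contains the set of these worlds makes \<open>A\<close> necessary.\<close>

lemma necessary_setsI:
  assumes s: "filter_over (worlds M) s" and A: "A \<subseteq> worlds M"
    and box: "{x \<in> worlds M. \<forall>y. (x, y) \<in> rel M \<longrightarrow> y \<in> A} \<in> s"
  shows "A \<in> necessary_sets M s"
proof -
  have "m_Delta M (X \<union> A) \<in> s" for X
  proof (rule filter_overD(4)[OF s box])
    show "{x \<in> worlds M. \<forall>y. (x, y) \<in> rel M \<longrightarrow> y \<in> A} \<subseteq> m_Delta M (X \<union> A)"
      unfolding m_Delta_def by blast
  qed (rule m_Delta_subset)
  with A show ?thesis unfolding necessary_sets_def by simp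
qed

text \<open>For a principal ultrafilter this says that \<open>A\<close> is noncontingent at a world iff all
  successors lie in \<open>A\<close> or all lie outside. The implication from left to right
  needs \<open>s\<close> to be an ultrafilter: \<open>m_Delta M A\<close> is the union of the two corresponding sets of
  worlds, so one of these belongs to \<open>s\<close>. The converse takes \<open>X = {}\<close> in the definition of
  necessity.\<close>

lemma m_Delta_in_ultrafilter_iff:
  assumes M: "kripke_model M" and s: "s \<in> Uf (worlds M)" and A: "A \<subseteq> worlds M"
  shows "m_Delta M A \<in> s \<longleftrightarrow> A \<in> necessary_sets M s \<or> worlds M - A \<in> necessary_sets M s"
proof
  assume mA: "m_Delta M A \<in> s"
  note fs = Uf_filter_over[OF s]
  let ?B = "{x \<in> worlds M. \<forall>y. (x, y) \<in> rel M \<longrightarrow> y \<in> A}"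
  let ?C = "{x \<in> worlds M. \<forall>y. (x, y) \<in> rel M \<longrightarrow> y \<in> worlds M - A}"
  show "A \<in> necessary_sets M s \<or> worlds M - A \<in> necessary_sets M s"
  proof (cases "?B \<in> s")
    case True
    then show ?thesis using necessary_setsI[OF fs A] by simp
  next
    case False
    then have "worlds M - ?B \<in> s"
      using ultrafilter_Compl_iff[OF s, of ?B] by auto
    then have "m_Delta M A \<inter> (worlds M - ?B) \<in> s"
      using mA by (rule filter_overD(3)[OF fs, rotated])
    moreover have "m_Delta M A \<inter> (worlds M - ?B) \<subseteq> ?C"
      using M unfolding m_Delta_def kripke_model_def by blast
    ultimately have "?C \<in> s" by (rule filter_overD(4)[OF fs]) auto
    then show ?thesis using necessary_setsI[OF fs Diff_subset] by simp
  qed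
next
  assume "A \<in> necessary_sets M s \<or> worlds M - A \<in> necessary_sets M s"
  then have "m_Delta M ({} \<union> A) \<in> s \<or> m_Delta M ({} \<union> (worlds M - A)) \<in> s"
    using necessary_setsD(2)[OF _ empty_subsetI] by blast
  then show "m_Delta M A \<in> s" using m_Delta_Compl[OF M] by simp
qed

text \<open>The existence of witnesses is where the ultrafilter theorem enters; their absence when
  \<open>A\<close> is noncontingent is immediate, since all successors include the necessary sets.\<close>

lemma ue_successors_disagree_iff:
  assumes M: "kripke_model M" and s: "s \<in> Uf (worlds M)" and A: "A \<subseteq> worlds M"
  shows "m_Delta M A \<notin> s \<longleftrightarrow>
    (\<exists>t u. (s, t) \<in> rel (ue M) \<and> (s, u) \<in> rel (ue M) \<and> A \<in> t \<and> A \<notin> u)"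
proof -
  let ?N = "necessary_sets M s"
  have N: "filter_over (worlds M) ?N"
    by (rule filter_over_necessary_sets[OF M Uf_filter_over[OF s]])
  have ultra: "worlds M - A \<in> t \<longleftrightarrow> A \<notin> t" if "(s, t) \<in> rel (ue M)" for t
    using that ultrafilter_Compl_iff[OF _ A] unfolding rel_ue_iff by blast
  have extend: "\<exists>t. (s, t) \<in> rel (ue M) \<and> B \<in> t" if B: "B \<subseteq> worlds M" "worlds M - B \<notin> ?N" for B
  proof -
    obtain t where "ultrafilter_over (worlds M) t" "?N \<subseteq> t" "B \<in> t"
      using filter_extends_to_ultrafilter[OF N B] by blast
    moreover from this(1) have "t \<in> Uf (worlds M)" unfolding Uf_def by simp
    ultimately show ?thesis using s unfolding rel_ue_iff by blast
  qed
  show ?thesis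
  proof
    assume "m_Delta M A \<notin> s"
    then have "A \<notin> ?N" "worlds M - A \<notin> ?N"
      using m_Delta_in_ultrafilter_iff[OF M s A] by simp_all
    moreover have "worlds M - (worlds M - A) = A" using A by auto
    ultimately obtain t u where tu: "(s, t) \<in> rel (ue M)" "A \<in> t"
      "(s, u) \<in> rel (ue M)" "worlds M - A \<in> u"
      using extend[OF A] extend[OF Diff_subset, of A] by auto
    have "A \<notin> u" using ultra[OF tu(3)] tu(4) by simp
    with tu show "\<exists>t u. (s, t) \<in> rel (ue M) \<and> (s, u) \<in> rel (ue M) \<and> A \<in> t \<and> A \<notin> u"
      by blast
  next
    assume "\<exists>t u. (s, t) \<in> rel (ue M) \<and> (s, u) \<in> rel (ue M) \<and> A \<in> t \<and> A \<notin> u"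
    then obtain t u where tu: "(s, t) \<in> rel (ue M)" "(s, u) \<in> rel (ue M)" "A \<in> t" "A \<notin> u"
      by blast
    have "?N \<subseteq> t" "?N \<subseteq> u" using tu(1,2) unfolding rel_ue_iff by simp_all
    moreover have "worlds M - A \<notin> t" using ultra[OF tu(1)] tu(3) by simp
    ultimately have "A \<notin> ?N" "worlds M - A \<notin> ?N"
      using tu(4) by (auto dest: subsetD)
    then show "m_Delta M A \<notin> s"
      using m_Delta_in_ultrafilter_iff[OF M s A] by simp
  qed
qed

section \<open>Truth in the ultrafilter extension\<close>

lemma truth_set_subset: "truth_set M \<phi> \<subseteq> worlds M"
  unfolding truth_set_def by blast

lemma truth_set_Prop:
  assumes "kripke_model M"
  shows "truth_set M (Prop p) = val M p"
proof -
  have "val M p \<subseteq> worlds M" using assms unfolding kripke_model_def by simp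
  then show ?thesis unfolding truth_set_def by auto
qed

lemma truth_set_Neg: "truth_set M (Neg \<phi>) = worlds M - truth_set M \<phi>"
  unfolding truth_set_def by auto

lemma truth_set_Conj: "truth_set M (Conj \<phi> \<psi>) = truth_set M \<phi> \<inter> truth_set M \<psi>"
  unfolding truth_set_def by auto

lemma truth_set_Nabla:
  assumes "kripke_model M"
  shows "truth_set M (Nabla \<phi>) = worlds M - m_Delta M (truth_set M \<phi>)"
proof -
  have "t \<in> worlds M" if "(s, t) \<in> rel M" for s t
    using assms that unfolding kripke_model_def by blast
  then show ?thesis unfolding truth_set_def m_Delta_def sat.simps by blast
qed

lemma truth_set_in_ultrafilter_iff:
  assumes M: "kripke_model M" and "s \<in> Uf (worlds M)"
  shows "truth_set M \<phi> \<in> s \<longleftrightarrow> sat (ue M) s \<phi>"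
  using assms(2)
proof (induction \<phi> arbitrary: s)
  case (Prop p)
  then show ?case by (simp add: truth_set_Prop[OF M] ue_def)
next
  case (Neg \<phi>)
  then show ?case
    by (simp add: truth_set_Neg ultrafilter_Compl_iff[OF _ truth_set_subset])
next
  case (Conj \<phi> \<psi>)
  then show ?case
    by (simp add: truth_set_Conj ultrafilter_Int_iff[OF _ truth_set_subset truth_set_subset])
next
  case (Nabla \<phi>)
  have "truth_set M (Nabla \<phi>) \<in> s \<longleftrightarrow> m_Delta M (truth_set M \<phi>) \<notin> s"
    by (simp add: truth_set_Nabla[OF M] ultrafilter_Compl_iff[OF Nabla.prems m_Delta_subset])
  also have "\<dots> \<longleftrightarrow> (\<exists>t u. (s, t) \<in> rel (ue M) \<and> (s, u) \<in> rel (ue M) \<and>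
      truth_set M \<phi> \<in> t \<and> truth_set M \<phi> \<notin> u)"
    by (rule ue_successors_disagree_iff[OF M Nabla.prems truth_set_subset])
  also have "\<dots> \<longleftrightarrow> sat (ue M) s (Nabla \<phi>)"
  proof -
    have "truth_set M \<phi> \<in> t \<longleftrightarrow> sat (ue M) t \<phi>" "t \<in> Uf (worlds M)"
      if "(s, t) \<in> rel (ue M)" for t
      using that Nabla.IH unfolding rel_ue_iff by simp_all
    then show ?thesis unfolding sat.simps worlds_ue by blast
  qed
  finally show ?case .
qed

theorem proposition24:
  fixes M :: "('w, 'p) kripke"
  assumes "kripke_model M"
  shows "(\<forall>(\<phi> :: 'p fm). \<forall>s\<in>Uf (worlds M).
            truth_set M \<phi> \<in> s \<longleftrightarrow> sat (ue M) s \<phi>) \<and>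
         (\<forall>w\<in>worlds M. nabla_equiv M w (ue M) (principal_uf (worlds M) w))"
proof (intro conjI allI ballI)
  show "truth_set M \<phi> \<in> s \<longleftrightarrow> sat (ue M) s \<phi>" if "s \<in> Uf (worlds M)" for \<phi> s
    by (rule truth_set_in_ultrafilter_iff[OF assms that])
next
  fix w assume w: "w \<in> worlds M"
  have "sat M w \<phi> \<longleftrightarrow> truth_set M \<phi> \<in> principal_uf (worlds M) w" for \<phi>
    using w by (auto simp: truth_set_def principal_uf_def)
  then show "nabla_equiv M w (ue M) (principal_uf (worlds M) w)"
    unfolding nabla_equiv_def
    using truth_set_in_ultrafilter_iff[OF assms principal_uf_in_Uf[OF w]] by simp
qed

end
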